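(* Let $X$ be a Banach space and let $\{x_n\}$ be a bounded sequence in $X$ that is almost overcomplete in $X$. Then $\{x_n\}$ is relatively norm-compact, i.e. the norm closure of the set $\{x_n : n\in\mathbb N\}$ is compact in $X$.
   Context: A sequence $\{x_n\}$ in a Banach space $X$ is called almost overcomplete if, for every subsequence $\{x_{n_k}\}$, the closed linear span $[\{x_{n_k}\}]$ has finite codimension in $X$. *)

theory Defs
  imports "HOL-Analysis.Analysis"
begin

text \<open>
  A Banach space may be real or complex. The scalar field is a type \<open>'k\<close> that is a
  finite-dimensional commutative normed division algebra over the reals, so by Frobenius it is,
  isometrically, the field of real or of complex numbers (both types are instances).
  The norm, the metric and completeness come from the class \<^class>\<open>banach\<close>; the scalar
  multiplication is \<open>scale\<close>, so that linear spans are taken over \<open>'k\<close>.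
\<close>

locale banach_space_over = vector_space scale
  for scale :: "'k::{real_normed_field,euclidean_space} \<Rightarrow> 'a::banach \<Rightarrow> 'a" +
  assumes norm_scale: "norm (scale c v) = norm c * norm v"
    and scale_of_real: "scale (of_real r) v = r *\<^sub>R v"
begin

definition closed_span :: "'a set \<Rightarrow> 'a set" where
  "closed_span S = closure (span S)"

text \<open>
  For a subspace \<open>Y\<close>: the quotient by \<open>Y\<close> is finite-dimensional, i.e. it is spanned by the
  cosets of finitely many vectors.
\<close>

definition finite_codimension :: "'a set \<Rightarrow> bool" where
  "finite_codimension Y \<longleftrightarrow> (\<exists>B. finite B \<and> (\<forall>v. \<exists>b\<in>span B. v - b \<in> Y))"

definition almost_overcomplete :: "(nat \<Rightarrow> 'a) \<Rightarrow> bool" where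
  "almost_overcomplete x \<longleftrightarrow>
     (\<forall>r::nat \<Rightarrow> nat. strict_mono r \<longrightarrow> finite_codimension (closed_span (range (x \<circ> r))))"

end

lemma banach_space_over_real: "banach_space_over (scaleR :: real \<Rightarrow> 'a::banach \<Rightarrow> 'a)"
  by unfold_locales (simp_all add: algebra_simps)

lemma banach_space_over_complex: "banach_space_over ((*) :: complex \<Rightarrow> complex \<Rightarrow> complex)"
  by unfold_locales (simp_all add: algebra_simps norm_mult scaleR_conv_of_real)

lemma closed_span_real:
  "banach_space_over.closed_span scaleR S = closure (span (S :: 'a::banach set))"
  by (simp add: banach_space_over.closed_span_def[OF banach_space_over_real] span_raw_def)

end

theory Submission
  imports Defs "HOL-Library.Diagonal_Subsequence"
begin

text \<open>
  If the bounded sequence \<open>x\<close> is not relatively compact, it has a norm-separated subsequence, and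
  the claim is that this one has a uniformly minimal subsequence: no term is close to the span of
  the other terms. Then the even terms span a closed subspace modulo which the odd terms are
  linearly independent, so its codimension is infinite.

  For the minimal subsequence, embed the span of \<open>x\<close> isometrically into the bounded real
  sequences (Hahn--Banach) and pass to a subsequence that converges coordinatewise, to \<open>\<phi>\<close> say.
  The differences \<open>w n = x n - \<phi>\<close> tend to zero coordinatewise but not in norm, so Mazur's argument
  extracts a basic sequence from \<open>\<phi>, w 0, w 1, \<dots>\<close> in which \<open>\<phi>\<close>, if nonzero, stays the first
  element. The coefficient functional of \<open>w j\<close> vanishes at \<open>\<phi>\<close>, so it takes the value 1 at \<open>x j\<close>
  and 0 at the other terms. To allow complex scalars \<open>c\<close>, everything is done for the real-linear
  maps \<open>c \<mapsto> c x n\<close> in place of the vectors \<open>x n\<close>.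
\<close>

section \<open>Hahn-Banach by way of minimal sublinear functionals\<close>

text \<open>Homogeneity is demanded only as an inequality, which is easier to check for infima;
  \<open>sublinear_scale\<close> recovers equality.\<close>

definition sublinear :: "('a::real_vector \<Rightarrow> real) \<Rightarrow> bool" where
  "sublinear p \<longleftrightarrow> (\<forall>x y. p (x + y) \<le> p x + p y) \<and> (\<forall>t\<ge>0. \<forall>x. p (t *\<^sub>R x) \<le> t * p x)"

lemma sublinearI:
  assumes "\<And>x y. p (x + y) \<le> p x + p y" "\<And>t x. 0 \<le> t \<Longrightarrow> p (t *\<^sub>R x) \<le> t * p x"
  shows "sublinear p"
  using assms by (simp add: sublinear_def)

lemma sublinear_add: "sublinear p \<Longrightarrow> p (x + y) \<le> p x + p y"
  and sublinear_scale_le: "sublinear p \<Longrightarrow> 0 \<le> t \<Longrightarrow> p (t *\<^sub>R x) \<le> t * p x"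
  by (simp_all add: sublinear_def)

lemma sublinear_zero: "sublinear p \<Longrightarrow> p 0 = 0"
  using sublinear_add[of p 0 0] sublinear_scale_le[of p 0 0] by simp

lemma sublinear_uminus_ge: "sublinear p \<Longrightarrow> - p (- x) \<le> p x"
  using sublinear_add[of p x "- x"] sublinear_zero[of p] by simp

lemma sublinear_scale:
  assumes "sublinear p" "0 \<le> t"
  shows "p (t *\<^sub>R x) = t * p x"
proof (cases "t = 0")
  case False
  have "p (inverse t *\<^sub>R (t *\<^sub>R x)) \<le> inverse t * p (t *\<^sub>R x)"
    using assms by (intro sublinear_scale_le) auto
  then have "t * p x \<le> p (t *\<^sub>R x)"
    using False assms by (simp add: field_simps)
  then show ?thesis
    using sublinear_scale_le[OF assms, of x] by simp
qed (use assms sublinear_zero in auto)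

text \<open>Lowering a sublinear functional in the direction \<open>a\<close> as far as sublinearity allows; a
  minimal sublinear functional is a fixed point of this for every \<open>a\<close>, hence superadditive.\<close>

definition lower_along :: "('a::real_vector \<Rightarrow> real) \<Rightarrow> 'a \<Rightarrow> 'a \<Rightarrow> real" where
  "lower_along p a x = (INF t\<in>{0..}. p (x + t *\<^sub>R a) - t * p a)"

lemma lower_along_le:
  assumes "sublinear p" "0 \<le> t"
  shows "lower_along p a x \<le> p (x + t *\<^sub>R a) - t * p a"
proof -
  have "- p (- x) \<le> p (x + s *\<^sub>R a) - s * p a" if "0 \<le> s" for s
    using sublinear_add[OF assms(1), of "x + s *\<^sub>R a" "- x"] sublinear_scale[OF assms(1) that, of a]
    by simp
  then have "bdd_below ((\<lambda>t. p (x + t *\<^sub>R a) - t * p a) ` {0..})"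
    by (intro bdd_belowI2) auto
  then show ?thesis
    unfolding lower_along_def using assms(2) by (intro cINF_lower) auto
qed

lemma lower_along_greatest:
  assumes "\<And>t. 0 \<le> t \<Longrightarrow> c \<le> p (x + t *\<^sub>R a) - t * p a"
  shows "c \<le> lower_along p a x"
  unfolding lower_along_def using assms by (intro cINF_greatest) auto

lemma lower_along_le_self: "sublinear p \<Longrightarrow> lower_along p a x \<le> p x"
  using lower_along_le[of p 0 a x] by simp

lemma sublinear_lower_along:
  assumes p: "sublinear p"
  shows "sublinear (lower_along p a)"
proof (rule sublinearI)
  fix x y
  \<comment> \<open>The parameters of the two summands merge into \<open>s + t\<close>; the infima
    over \<open>t\<close> and then over \<open>s\<close> are taken one after the other.\<close>
  have *: "lower_along p a (x + y) \<le> (p (x + s *\<^sub>R a) - s * p a) + (p (y + t *\<^sub>R a) - t * p a)"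
    if "0 \<le> s" "0 \<le> t" for s t
    using lower_along_le[OF p, of "s + t" a "x + y"] that
      sublinear_add[OF p, of "x + s *\<^sub>R a" "y + t *\<^sub>R a"]
    by (simp add: algebra_simps)
  have "lower_along p a (x + y) - (p (x + s *\<^sub>R a) - s * p a) \<le> lower_along p a y" if "0 \<le> s" for s
    using *[OF that] by (intro lower_along_greatest) (simp add: algebra_simps)
  then have "lower_along p a (x + y) - lower_along p a y \<le> lower_along p a x"
    by (intro lower_along_greatest) (simp add: algebra_simps)
  then show "lower_along p a (x + y) \<le> lower_along p a x + lower_along p a y"
    by simp
next
  fix t :: real and x
  assume t: "0 \<le> t"
  have *: "lower_along p a (t *\<^sub>R x) \<le> t * (p (x + s *\<^sub>R a) - s * p a)" if "0 \<le> s" for s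
    using lower_along_le[OF p, of "t * s" a "t *\<^sub>R x"] that t
      sublinear_scale[OF p t, of "x + s *\<^sub>R a"]
    by (simp add: algebra_simps)
  show "lower_along p a (t *\<^sub>R x) \<le> t * lower_along p a x"
  proof (cases "t = 0")
    case True
    then show ?thesis using *[of 0] by simp
  next
    case False
    then have "lower_along p a (t *\<^sub>R x) / t \<le> lower_along p a x"
      using * t by (intro lower_along_greatest) (simp add: field_simps)
    then show ?thesis using False t by (simp add: field_simps)
  qed
qed

text \<open>Zorn's lemma for the reversed pointwise order: the pointwise infimum of a nonempty chain
  is again sublinear, and \<open>q\<close> itself bounds the empty chain.\<close>

lemma minimal_sublinear_below:
  assumes q: "sublinear q"
  obtains m where "sublinear m" "\<And>x. m x \<le> q x"
    "\<And>p. sublinear p \<Longrightarrow> (\<And>x. p x \<le> m x) \<Longrightarrow> p = m"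
proof -
  define A where "A = {p. sublinear p \<and> p \<le> q}"
  have "\<exists>m\<in>A. \<forall>a\<in>A. a \<le> m \<longrightarrow> a = m"
  proof (rule predicate_Zorn)
    show "partial_order_on A (relation_of (\<lambda>a b. b \<le> a) A)"
      by (auto simp: partial_order_on_def preorder_on_def refl_on_def trans_def antisym_def
          relation_of_def)
    fix C
    assume C: "C \<in> Chains (relation_of (\<lambda>a b. b \<le> a) A)"
    show "\<exists>u\<in>A. \<forall>a\<in>C. u \<le> a"
    proof (cases "C = {}")
      case True
      then show ?thesis using q by (auto simp: A_def)
    next
      case False
      have CA: "sublinear p" "p x \<le> q x" if "p \<in> C" for p x
        using C that by (auto simp: Chains_def relation_of_def A_def le_fun_def)
      have total: "p \<le> p' \<or> p' \<le> p" if "p \<in> C" "p' \<in> C" for p p'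
        using C that by (auto simp: Chains_def relation_of_def)
      define u where "u x = (INF p\<in>C. p x)" for x
      \<comment> \<open>Members of \<open>C\<close> lie below \<open>q\<close>, so
        \<open>- p (- x) \<le> p x\<close> gives all of them one common lower bound.\<close>
      have "- q (- x) \<le> p x" if "p \<in> C" for p x
        using sublinear_uminus_ge[OF CA(1)[OF that], of x] CA(2)[OF that, of "- x"] by simp
      then have bdd: "bdd_below ((\<lambda>p. p x) ` C)" for x
        by (intro bdd_belowI2) auto
      have le: "u x \<le> p x" if "p \<in> C" for p x
        unfolding u_def using bdd that by (intro cINF_lower)
      have ge: "c \<le> u x" if "\<And>p. p \<in> C \<Longrightarrow> c \<le> p x" for c x
        unfolding u_def using False that by (intro cINF_greatest)
      have "sublinear u"
      proof (rule sublinearI)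
        fix x y
        \<comment> \<open>In a chain the smaller of \<open>p\<close> and \<open>p'\<close> serves at
          both points, so subadditivity of a single functional suffices.\<close>
        have *: "u (x + y) \<le> p x + p' y" if p: "p \<in> C" "p' \<in> C" for p p'
        proof -
          obtain p'' where p'': "p'' \<in> C" "p'' x \<le> p x" "p'' y \<le> p' y"
            using total[OF p] p by (auto simp: le_fun_def)
          then show ?thesis
            using le[OF p''(1), of "x + y"] sublinear_add[OF CA(1)[OF p''(1)], of x y] by simp
        qed
        then have "u (x + y) - p x \<le> u y" if "p \<in> C" for p
          using *[OF that] by (intro ge) (simp add: algebra_simps)
        then have "u (x + y) - u y \<le> u x"
          by (intro ge) (simp add: algebra_simps)
        then show "u (x + y) \<le> u x + u y" by simp
      next
        fix t :: real and x
        assume t: "0 \<le> t"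
        have *: "u (t *\<^sub>R x) \<le> t * p x" if "p \<in> C" for p
          using le[OF that, of "t *\<^sub>R x"] sublinear_scale[OF CA(1)[OF that] t, of x] by simp
        show "u (t *\<^sub>R x) \<le> t * u x"
        proof (cases "t = 0")
          case True
          then show ?thesis using * False by auto
        next
          case False
          then have "u (t *\<^sub>R x) / t \<le> u x"
            using * t by (intro ge) (simp add: field_simps)
          then show ?thesis using False t by (simp add: field_simps)
        qed
      qed
      moreover have "u \<le> q"
        using False le CA(2) by (fastforce simp: le_fun_def intro: order_trans)
      ultimately show ?thesis
        using le by (auto simp: A_def le_fun_def)
    qed
  qed
  then show thesis
    using that by (auto simp: A_def le_fun_def dest: order_trans) (metis order_trans)
qed

text \<open>A minimal \<open>m\<close> is fixed by every \<open>lower_along m a\<close>; at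
  \<open>t = 1\<close> this is superadditivity. Additivity makes \<open>m\<close> odd, which extends
  homogeneity to negative scalars.\<close>

lemma linear_below_sublinear:
  assumes "sublinear q"
  obtains f where "linear f" "\<And>x. f x \<le> q x"
proof -
  obtain m where m: "sublinear m" "\<And>x. m x \<le> q x"
    and min: "\<And>p. sublinear p \<Longrightarrow> (\<And>x. p x \<le> m x) \<Longrightarrow> p = m"
    using minimal_sublinear_below[OF assms] by blast
  have "lower_along m a = m" for a
    using m(1) by (intro min sublinear_lower_along lower_along_le_self)
  then have "m x \<le> m (x + a) - m a" for x a
    using lower_along_le[OF m(1), of 1 a x] by simp
  then have add: "m (x + y) = m x + m y" for x y
    using sublinear_add[OF m(1), of x y] by (smt (verit))
  have minus: "m (- x) = - m x" for x
    using add[of x "- x"] sublinear_zero[OF m(1)] by simp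
  have "m (t *\<^sub>R x) = t * m x" for t x
  proof (cases "0 \<le> t")
    case False
    then show ?thesis
      using sublinear_scale[OF m(1), of "- t" x] minus[of "t *\<^sub>R x"] by simp
  qed (simp add: sublinear_scale[OF m(1)])
  then have "linear m"
    by (intro linearI) (simp_all add: add)
  then show thesis
    using that m(2) by blast
qed

text \<open>Choosing \<open>f\<close> below \<open>lower_along norm v\<close> instead of
  \<open>norm\<close> forces its value at \<open>v\<close>: the parameter \<open>t = 1\<close> at
  the point \<open>- v\<close> gives \<open>f (- v) \<le> - norm v\<close>.\<close>

lemma norming_functional:
  fixes v :: "'a::real_normed_vector"
  obtains f :: "'a \<Rightarrow> real" where "linear f" "\<And>x. \<bar>f x\<bar> \<le> norm x" "f v = norm v"
proof -
  have n: "sublinear (norm :: 'a \<Rightarrow> real)"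
    by (rule sublinearI) (simp_all add: norm_triangle_ineq)
  obtain f where f: "linear f" "\<And>x. f x \<le> lower_along norm v x"
    using linear_below_sublinear[OF sublinear_lower_along[OF n]] by blast
  have le: "f x \<le> norm x" for x
    using f(2)[of x] lower_along_le_self[OF n, of v x] by simp
  have minus: "f (- x) = - f x" for x
    using f(1) by (simp add: linear_neg)
  have "f (- v) \<le> - norm v"
    using f(2)[of "- v"] lower_along_le[OF n, of 1 v "- v"] by simp
  then have "f v = norm v"
    using le[of v] minus[of v] by simp
  moreover have "\<bar>f x\<bar> \<le> norm x" for x
    using le[of x] le[of "- x"] minus[of x] by simp
  ultimately show thesis
    using that f(1) by blast
qed

section \<open>Compactness and extraction of subsequences\<close>

text \<open>Bolzano-Weierstrass in a finite-dimensional subspace of a normed space. Since the limit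
  stays in \<open>span B\<close>, the induction hypothesis also yields that \<open>span B\<close> is
  closed, hence at positive distance from a new generator \<open>b\<close>.\<close>

lemma bounded_span_finite_convergent_subseq:
  fixes B :: "'a::real_normed_vector set"
  assumes "finite B" "\<And>n. e n \<in> span B" "bounded (range e)"
  shows "\<exists>l\<in>span B. \<exists>r::nat\<Rightarrow>nat. strict_mono r \<and> (e \<circ> r) \<longlonglongrightarrow> l"
  using assms
proof (induction B arbitrary: e rule: finite_induct)
  case empty
  then have "e \<circ> id = (\<lambda>_. 0)" by auto
  then show ?case by (intro bexI exI[of _ id]) (auto simp: strict_mono_def)
next
  case (insert b B)
  show ?case
  proof (cases "b \<in> span B")
    case True
    then have "span (insert b B) = span B" by (rule span_redundant)
    then show ?thesis using insert.IH[of e] insert.prems by simp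
  next
    case False
    have "closed (span B)"
    proof (subst closed_sequential_limits, intro allI impI, elim conjE)
      fix y l
      assume y: "\<forall>n. y n \<in> span B" "y \<longlonglongrightarrow> l"
      then have "bounded (range y)"
        by (simp add: convergent_imp_bounded convergentI)
      then obtain l' r where "l' \<in> span B" "strict_mono r" "(y \<circ> r) \<longlonglongrightarrow> l'"
        using insert.IH y by blast
      then show "l \<in> span B"
        using LIMSEQ_unique[OF LIMSEQ_subseq_LIMSEQ[OF y(2)]] by blast
    qed
    then obtain d where d: "d > 0" "ball b d \<subseteq> - span B"
      using False openE[of "- span B" b] by auto
    then have d_le: "d \<le> dist b y" if "y \<in> span B" for y
      using that by (force simp: not_less[symmetric])
    \<comment> \<open>Dividing by \<open>t\<close> turns the vector into \<open>b\<close> minus a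
      point of \<open>span B\<close>, so the distance \<open>d\<close> controls the coefficient of
      \<open>b\<close>.\<close>
    have lower: "d * \<bar>t\<bar> \<le> norm (y + t *\<^sub>R b)" if y: "y \<in> span B" for y t
    proof (cases "t = 0")
      case False
      have "(- inverse t) *\<^sub>R y \<in> span B" using y by (rule span_scale)
      then have "d \<le> norm (b + inverse t *\<^sub>R y)"
        using d_le[of "(- inverse t) *\<^sub>R y"] by (simp add: dist_norm)
      also have "\<dots> = norm (inverse t *\<^sub>R (y + t *\<^sub>R b))"
        using False by (simp add: algebra_simps)
      also have "\<dots> = norm (y + t *\<^sub>R b) / \<bar>t\<bar>"
        by (simp add: divide_inverse_commute)
      finally show ?thesis
        using False by (simp add: le_divide_eq)
    qed simp
    have "\<exists>t. e n - t *\<^sub>R b \<in> span B" for n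
      using insert.prems(1) by (simp add: span_breakdown_eq)
    then obtain t where t: "\<And>n. e n - t n *\<^sub>R b \<in> span B" by metis
    obtain M where M: "\<And>n. norm (e n) \<le> M"
      using insert.prems(2) by (auto simp: bounded_iff)
    have "d * \<bar>t n\<bar> \<le> M" for n
      using lower[OF t[of n], of "t n"] M[of n] by simp
    then have "bounded (range t)"
      using d(1) by (intro boundedI[of _ "M / d"]) (auto simp: field_simps)
    then obtain l r where l: "strict_mono r" "(t \<circ> r) \<longlonglongrightarrow> l"
      using bounded_imp_convergent_subsequence[of t] by blast
    define y where "y = (\<lambda>n. e (r n) - t (r n) *\<^sub>R b)"
    obtain T where T: "\<And>n. \<bar>t n\<bar> \<le> T"
      using \<open>bounded (range t)\<close> by (auto simp: bounded_iff)
    have "norm (y n) \<le> M + T * norm b" for n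
      unfolding y_def
      by (rule order_trans[OF norm_triangle_ineq4])
        (use M T in \<open>auto intro!: add_mono mult_right_mono\<close>)
    then have "bounded (range y)"
      by (intro boundedI[of _ "M + T * norm b"]) auto
    then obtain z s where z: "z \<in> span B" "strict_mono s" "(y \<circ> s) \<longlonglongrightarrow> z"
      using insert.IH[of y] t unfolding y_def by blast
    have "(\<lambda>n. (y \<circ> s) n + (t \<circ> r \<circ> s) n *\<^sub>R b) \<longlonglongrightarrow> z + l *\<^sub>R b"
      using z(3) LIMSEQ_subseq_LIMSEQ[OF l(2) z(2)] by (intro tendsto_intros)
    then have "(e \<circ> (r \<circ> s)) \<longlonglongrightarrow> z + l *\<^sub>R b"
      by (simp add: y_def o_def)
    moreover have "z + l *\<^sub>R b \<in> span (insert b B)"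
      using z(1) by (simp add: span_breakdown_eq) (metis add_diff_cancel_right')
    ultimately show ?thesis
      using strict_mono_o[OF l(1) z(2)] by blast
  qed
qed

text \<open>The closure is complete but not compact, so it is not totally bounded and a greedy
  choice of far away terms never stops.\<close>

lemma separated_subsequence:
  fixes x :: "nat \<Rightarrow> 'a::{complete_space}"
  assumes "\<not> compact (closure (range x))"
  obtains r :: "nat \<Rightarrow> nat" and d where "strict_mono r" "d > 0"
    "\<And>i j. i \<noteq> j \<Longrightarrow> d \<le> dist (x (r i)) (x (r j))"
proof -
  have "complete (closure (range x))"
    by (simp add: complete_eq_closed)
  then obtain \<epsilon> where \<epsilon>: "\<epsilon> > 0" "\<And>k. finite k \<Longrightarrow> \<not> closure (range x) \<subseteq> (\<Union>y\<in>k. ball y \<epsilon>)"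
    using assms unfolding compact_eq_totally_bounded by blast
  \<comment> \<open>Halving leaves room to pass from closed balls, whose finite union is closed and
    so absorbs the closure, to open balls of radius \<open>\<epsilon>\<close>.\<close>
  define d where "d = \<epsilon> / 2"
  have d: "d > 0" using \<epsilon> by (simp add: d_def)
  have far: "\<exists>n>m. \<forall>i\<le>m. d \<le> dist (x i) (x n)" for m
  proof (rule ccontr)
    assume "\<not> ?thesis"
    then have near: "\<And>n. n > m \<Longrightarrow> \<exists>i\<le>m. dist (x i) (x n) < d"
      by (meson not_le)
    have "range x \<subseteq> (\<Union>y\<in>x ` {..m}. cball y d)"
    proof clarify
      fix n
      show "x n \<in> (\<Union>y\<in>x ` {..m}. cball y d)"
      proof (cases "n > m")
        case True
        then show ?thesis using near[OF True] by fastforce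
      qed (use d in \<open>force simp: not_less\<close>)
    qed
    then have "closure (range x) \<subseteq> (\<Union>y\<in>x ` {..m}. cball y d)"
      by (intro closure_minimal) auto
    also have "\<dots> \<subseteq> (\<Union>y\<in>x ` {..m}. ball y \<epsilon>)"
      using \<epsilon>(1) by (fastforce simp: d_def)
    finally show False using \<epsilon>(2)[of "x ` {..m}"] by blast
  qed
  \<comment> \<open>Distance is kept from all earlier \<open>x i\<close>, selected or not, so each
    choice depends only on the previous index.\<close>
  obtain r :: "nat \<Rightarrow> nat" where r: "\<And>k. r k < r (Suc k)"
    "\<And>k i. i \<le> r k \<Longrightarrow> d \<le> dist (x i) (x (r (Suc k)))"
    using dependent_nat_choice[of "\<lambda>_ _. True" "\<lambda>_ m n. m < n \<and> (\<forall>i\<le>m. d \<le> dist (x i) (x n))"] far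
    by blast
  have mono: "strict_mono r" using r(1) by (simp add: strict_mono_Suc_iff)
  have less: "d \<le> dist (x (r i)) (x (r j))" if "i < j" for i j
  proof -
    obtain k where k: "j = Suc k" "i \<le> k" using \<open>i < j\<close> by (cases j) auto
    then show ?thesis using r(2) mono by (simp add: strict_mono_less_eq)
  qed
  then have "d \<le> dist (x (r i)) (x (r j))" if "i \<noteq> j" for i j
    using that by (metis dist_commute linorder_neqE_nat)
  then show thesis using that mono d by blast
qed

text \<open>Cantor's diagonal argument over the coordinates \<open>i\<close>, with
  Bolzano-Weierstrass at each stage.\<close>

lemma bounded_family_pointwise_convergent_subseq:
  fixes g :: "nat \<Rightarrow> nat \<Rightarrow> 'b::euclidean_space"
  assumes "\<And>n i. norm (g n i) \<le> M"
  obtains l and r :: "nat \<Rightarrow> nat" where "strict_mono r" "\<And>i. (\<lambda>n. g (r n) i) \<longlonglongrightarrow> l i"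
proof -
  interpret subseqs "\<lambda>i s. convergent (\<lambda>n. g (s n) i)"
  proof
    fix i and s :: "nat \<Rightarrow> nat"
    have "bounded (range (\<lambda>n. g (s n) i))"
      using assms by (intro boundedI) auto
    then show "\<exists>r'. strict_mono r' \<and> convergent (\<lambda>n. g ((s \<circ> r') n) i)"
      using bounded_imp_convergent_subsequence[of "\<lambda>n. g (s n) i"]
      by (auto simp: o_def convergent_def)
  qed
  \<comment> \<open>Only from index \<open>Suc i\<close> on is the diagonal sequence known to run
    inside the stage that settles coordinate \<open>i\<close>; the shift is removed
    afterwards.\<close>
  have "convergent (\<lambda>n. g ((diagseq \<circ> (+) (Suc i)) n) i)" for i
  proof (rule diagseq_holds)
    fix r s :: "nat \<Rightarrow> nat" and i
    assume "strict_mono r" "convergent (\<lambda>n. g (s n) i)"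
    then show "convergent (\<lambda>n. g ((s \<circ> r) n) i)"
      using convergent_subseq_convergent[of "\<lambda>n. g (s n) i" r] by (simp add: o_def)
  qed
  then have "convergent (\<lambda>n. g (diagseq (n + Suc i)) i)" for i
    by (simp add: o_def add.commute del: add_Suc add_Suc_right)
  then have "convergent (\<lambda>n. g (diagseq n) i)" for i
    using convergent_ignore_initial_segment[of "\<lambda>n. g (diagseq n) i" "Suc i"] by simp
  then show thesis
    using that[OF subseq_diagseq, of "\<lambda>i. lim (\<lambda>n. g (diagseq n) i)"]
    by (simp add: convergent_LIMSEQ_iff)
qed

section \<open>Mazur's argument in the space of bounded sequences\<close>

text \<open>Unit vectors of \<open>span B\<close> that violate the estimate cluster at a unit vector
  \<open>l\<close>, by finite dimension. The parameters \<open>c n\<close> stay bounded, so the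
  perturbations die out in each coordinate and the supremum norm of \<open>l\<close> is at most
  \<open>q\<close>, which is below 1.\<close>

lemma coordinatewise_null_almost_transversal:
  fixes W :: "nat \<Rightarrow> 'k::euclidean_space \<Rightarrow> (nat \<Rightarrow>\<^sub>C real)"
  assumes B: "finite B" and lin: "\<And>n. linear (W n)"
    and lower: "\<delta> > 0" "\<And>n c. \<delta> * norm c \<le> norm (W n c)"
    and null: "\<And>i. h i \<longlonglongrightarrow> 0" "\<And>n c i. \<bar>apply_bcontfun (W n c) i\<bar> \<le> h i n * norm c"
    and q: "q < 1"
  shows "\<forall>\<^sub>F n in sequentially. \<forall>e\<in>span B. \<forall>c. q * norm e \<le> norm (e + W n c)"
proof (rule ccontr)
  assume "\<not> ?thesis"
  from not_eventually_sequentiallyD[OF this]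
  obtain r :: "nat \<Rightarrow> nat"
    where r: "strict_mono r" "\<And>n. \<exists>e\<in>span B. \<exists>c. norm (e + W (r n) c) < q * norm e"
    by (auto simp: not_le)
  have "\<exists>e c. e \<in> span B \<and> norm e = 1 \<and> norm (e + W (r n) c) \<le> q" for n
  proof -
    obtain e c where e: "e \<in> span B" "norm (e + W (r n) c) < q * norm e" using r by blast
    have "e \<noteq> 0" using e(2) by auto
    define t where "t = inverse (norm e)"
    have t: "t > 0" "t * norm e = 1" using \<open>e \<noteq> 0\<close> by (simp_all add: t_def)
    have "norm (t *\<^sub>R e + W (r n) (t *\<^sub>R c)) = t * norm (e + W (r n) c)"
      using t(1) lin by (simp add: linear_scale flip: scaleR_add_right)
    also have "\<dots> \<le> t * (q * norm e)"
      using t e by (intro mult_left_mono) auto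
    also have "\<dots> = q" using t(2) by (simp add: mult.left_commute)
    finally show ?thesis
      using e(1) t by (intro exI[of _ "t *\<^sub>R e"]) (auto intro: span_scale)
  qed
  then obtain e c where e: "\<And>n. e n \<in> span B" "\<And>n. norm (e n) = 1"
    and ec: "\<And>n. norm (e n + W (r n) (c n)) \<le> q" by metis
  have "bounded (range e)" using e(2) by (intro boundedI[of _ 1]) auto
  then obtain l s where l: "strict_mono s" "(e \<circ> s) \<longlonglongrightarrow> l"
    using bounded_span_finite_convergent_subseq[of B e] B e(1) by blast
  have "norm l = 1"
    using tendsto_norm[OF l(2)] e(2) by (simp add: o_def LIMSEQ_const_iff)
  have c: "norm (c n) \<le> (q + 1) / \<delta>" for n
  proof -
    have "\<delta> * norm (c n) \<le> norm ((e n + W (r n) (c n)) - e n)" using lower(2) by simp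
    also have "\<dots> \<le> q + 1"
      using norm_triangle_ineq4[of "e n + W (r n) (c n)" "e n"] ec[of n] e(2)[of n] by simp
    finally show ?thesis using lower(1) by (simp add: field_simps)
  qed
  have "\<bar>apply_bcontfun l i\<bar> \<le> q" for i
  proof -
    have bound: "\<bar>apply_bcontfun (e (s n)) i\<bar> \<le> q + h i (r (s n)) * ((q + 1) / \<delta>)" for n
    proof -
      have "\<bar>apply_bcontfun (e (s n) + W (r (s n)) (c (s n))) i\<bar> \<le> q"
        using norm_bounded[of "e (s n) + W (r (s n)) (c (s n))" i] ec[of "s n"] by simp
      moreover have "h i (r (s n)) * norm (c (s n)) \<le> \<bar>h i (r (s n))\<bar> * ((q + 1) / \<delta>)"
        using c[of "s n"] by (intro mult_mono) auto
      \<comment> \<open>This is the coordinate bound at a basis vector, whose norm is 1.\<close>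
      moreover have "h i n \<ge> 0" for n
      proof -
        obtain b :: 'k where "b \<in> Basis" using nonempty_Basis by blast
        then show ?thesis using null(2)[of n b i] by simp
      qed
      ultimately show ?thesis
        using null(2)[of "r (s n)" "c (s n)" i] by auto
    qed
    have "(\<lambda>n. apply_bcontfun (e (s n)) i) \<longlonglongrightarrow> apply_bcontfun l i"
      using tendsto_uniform_limitI[OF tendsto_bcontfun_uniform_limit[OF l(2)], of i]
      by (simp add: o_def)
    then have "(\<lambda>n. \<bar>apply_bcontfun (e (s n)) i\<bar>) \<longlonglongrightarrow> \<bar>apply_bcontfun l i\<bar>"
      by (rule tendsto_rabs)
    moreover have "(\<lambda>n. q + h i (r (s n)) * ((q + 1) / \<delta>)) \<longlonglongrightarrow> q + 0 * ((q + 1) / \<delta>)"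
      using LIMSEQ_subseq_LIMSEQ[OF null(1)[of i] strict_mono_o[OF r(1) l(1)]]
      by (intro tendsto_intros) (simp add: o_def)
    ultimately have "\<bar>apply_bcontfun l i\<bar> \<le> q + 0 * ((q + 1) / \<delta>)"
      by (rule LIMSEQ_le) (use bound in blast)
    then show ?thesis by simp
  qed
  then have "norm l \<le> q" by (intro norm_bound) simp
  then show False using q \<open>norm l = 1\<close> by simp
qed

text \<open>Unit vectors with small images cluster at some \<open>l\<close>. The uniform bound
  \<open>K\<close> transfers the smallness to \<open>l\<close>: two of the maps send
  \<open>l\<close> to norm below \<open>d / 2\<close>, against their separation by
  \<open>d\<close>.\<close>

lemma eventually_uniformly_bounded_below:
  fixes W :: "nat \<Rightarrow> 'k::euclidean_space \<Rightarrow> 'v::real_normed_vector"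
  assumes lin: "\<And>n. linear (W n)" and upper: "\<And>n c. norm (W n c) \<le> K * norm c"
    and sep: "d > 0" "\<And>n m c. n \<noteq> m \<Longrightarrow> d * norm c \<le> norm (W n c - W m c)"
  shows "\<forall>\<^sub>F n in sequentially. \<forall>c. d / 4 * norm c \<le> norm (W n c)"
proof (rule ccontr)
  assume "\<not> ?thesis"
  from not_eventually_sequentiallyD[OF this]
  obtain r :: "nat \<Rightarrow> nat"
    where r: "strict_mono r" "\<And>n. \<exists>c. norm (W (r n) c) < d / 4 * norm c"
    by (auto simp: not_le)
  have "\<exists>c. norm c = 1 \<and> norm (W (r n) c) < d / 4" for n
  proof -
    obtain c where c: "norm (W (r n) c) < d / 4 * norm c" using r by blast
    then have "c \<noteq> 0" using lin by (auto simp: linear_0)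
    then have "norm (W (r n) (c /\<^sub>R norm c)) < d / 4"
      using c lin by (simp add: linear_scale field_simps)
    then show ?thesis using \<open>c \<noteq> 0\<close> by (intro exI[of _ "c /\<^sub>R norm c"]) simp
  qed
  then obtain c where c: "\<And>n. norm (c n) = 1" "\<And>n. norm (W (r n) (c n)) < d / 4" by metis
  have "bounded (range c)" using c(1) by (intro boundedI[of _ 1]) auto
  then obtain l s where l: "strict_mono s" "(c \<circ> s) \<longlonglongrightarrow> l"
    using bounded_imp_convergent_subsequence[of c] by blast
  have "norm l = 1"
    using tendsto_norm[OF l(2)] c(1) by (simp add: o_def LIMSEQ_const_iff)
  have "(\<lambda>n. K * norm (l - c (s n))) \<longlonglongrightarrow> K * norm (l - l)"
    using l(2) by (intro tendsto_intros) (simp add: o_def)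
  then have "\<forall>\<^sub>F n in sequentially. K * norm (l - c (s n)) < d / 4"
    using sep(1) by (intro order_tendstoD) auto
  then obtain N where N: "\<And>n. n \<ge> N \<Longrightarrow> K * norm (l - c (s n)) < d / 4"
    by (auto simp: eventually_sequentially)
  have small: "norm (W (r (s n)) l) < d / 2" if "n \<ge> N" for n
  proof -
    have "W (r (s n)) l = W (r (s n)) (l - c (s n)) + W (r (s n)) (c (s n))"
      using lin by (simp add: linear_diff)
    then have "norm (W (r (s n)) l) \<le> norm (W (r (s n)) (l - c (s n))) + norm (W (r (s n)) (c (s n)))"
      by (simp add: norm_triangle_ineq)
    then show ?thesis
      using upper[of "r (s n)" "l - c (s n)"] N[OF that] c(2)[of "s n"] by simp
  qed
  have "r (s N) \<noteq> r (s (Suc N))"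
    using r(1) l(1) by (simp add: strict_mono_eq)
  then show False
    using sep(2)[of "r (s N)" "r (s (Suc N))" l] small[of N] small[of "Suc N"] \<open>norm l = 1\<close>
      norm_triangle_ineq4[of "W (r (s N)) l" "W (r (s (Suc N))) l"] by simp
qed

section \<open>Embedding into the bounded sequences\<close>

text \<open>The coordinates of \<open>T\<close> are functionals norming the points of
  \<open>D\<close>, so \<open>T\<close> is contractive everywhere and isometric on \<open>D\<close>,
  hence on its closure. As \<open>nat\<close> is discrete,
  \<open>nat \<Rightarrow>\<^sub>C real\<close> consists of all bounded sequences.\<close>

lemma embedding_isometric_on_separable:
  fixes D :: "'a::real_normed_vector set"
  assumes "countable D"
  obtains T :: "'a \<Rightarrow> (nat \<Rightarrow>\<^sub>C real)" where "linear T" "\<And>y. norm (T y) \<le> norm y"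
    "\<And>y. y \<in> closure D \<Longrightarrow> norm (T y) = norm y"
proof -
  \<comment> \<open>Adding 0 keeps the set nonempty, so that \<open>from_nat_into\<close> takes its
    values in it even if \<open>D\<close> is empty.\<close>
  define D0 where "D0 = insert 0 D"
  have D0: "countable D0" "D0 \<noteq> {}" using assms by (auto simp: D0_def)
  have "\<exists>f :: 'a \<Rightarrow> real. linear f \<and> (\<forall>x. \<bar>f x\<bar> \<le> norm x) \<and> f v = norm v" for v
    using norming_functional[of v] by metis
  then obtain F :: "'a \<Rightarrow> 'a \<Rightarrow> real" where F: "\<And>v. linear (F v)" "\<And>v x. \<bar>F v x\<bar> \<le> norm x"
    "\<And>v. F v v = norm v" by metis
  define f where "f i = F (from_nat_into D0 i)" for i
  define T where "T y = Bcontfun (\<lambda>i. f i y)" for y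
  have "(\<lambda>i. f i y) \<in> bcontfun" for y
    unfolding f_def using F(2) by (intro bcontfun_normI[of _ "norm y"]) auto
  then have T: "apply_bcontfun (T y) i = f i y" for y i
    by (simp add: T_def Bcontfun_inverse)
  have lin: "linear T"
    using F(1) by (intro linearI bcontfun_eqI) (simp_all add: T f_def linear_add linear_scale)
  have le: "norm (T y) \<le> norm y" for y
    using F(2) by (intro norm_bound) (simp add: T f_def)
  have "norm y \<le> norm (T y)" if y: "y \<in> closure D" for y
  proof (rule field_le_epsilon)
    fix \<epsilon> :: real
    assume "\<epsilon> > 0"
    then obtain v where v: "v \<in> D" "dist v y < \<epsilon> / 2"
      using y closure_approachable by (metis half_gt_zero)
    obtain i where i: "from_nat_into D0 i = v"
      using from_nat_into_surj[OF D0(1), of v] v(1) by (auto simp: D0_def)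
    have "norm v = \<bar>apply_bcontfun (T v) i\<bar>"
      using F(3) by (simp add: T f_def i)
    also have "\<dots> \<le> norm (T v)"
      using norm_bounded[of "T v" i] by simp
    also have "\<dots> \<le> norm (T y) + norm (T (v - y))"
      using norm_triangle_ineq[of "T y" "T (v - y)"] lin by (simp add: linear_diff)
    also have "\<dots> \<le> norm (T y) + norm (v - y)" using le by simp
    finally have "norm v \<le> norm (T y) + norm (v - y)" .
    then show "norm y \<le> norm (T y) + \<epsilon>"
      using v(2) norm_triangle_sub[of y v] by (simp add: dist_norm norm_minus_commute)
  qed
  then show thesis using that lin le by (metis order_antisym)
qed

text \<open>Riesz representation; it allows a coordinate of a real-linear map on \<open>'k\<close>
  to be handled as a vector of \<open>'k\<close>.\<close>

lemma linear_functional_inner: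
  fixes f :: "'k::euclidean_space \<Rightarrow> real"
  assumes "linear f"
  shows "f c = (\<Sum>b\<in>Basis. f b *\<^sub>R b) \<bullet> c"
proof -
  have "f c = f (\<Sum>b\<in>Basis. (c \<bullet> b) *\<^sub>R b)" by (simp add: euclidean_representation)
  also have "\<dots> = (\<Sum>b\<in>Basis. (c \<bullet> b) * f b)"
    using assms by (simp add: linear_sum linear_scale)
  finally show ?thesis
    by (simp add: inner_sum_left inner_commute[of c] mult.commute)
qed

section \<open>Selection of a basic sequence\<close>

text \<open>A partial sum has norm at most twice that of any longer one, and each summand is a
  difference of two partial sums; this gives the factor 4. Every partial sum starts with
  \<open>\<phi> c\<close>, which cancels in these differences.\<close>

lemma uniformly_minimal_selection:
  fixes W :: "nat \<Rightarrow> 'k::euclidean_space \<Rightarrow> (nat \<Rightarrow>\<^sub>C real)"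
    and \<phi> :: "'k \<Rightarrow> (nat \<Rightarrow>\<^sub>C real)"
  assumes lin: "\<And>n. linear (W n)" "linear \<phi>"
    and lower: "\<delta> > 0" "\<And>n c. \<delta> * norm c \<le> norm (W n c)"
    and null: "\<And>i. h i \<longlonglongrightarrow> 0" "\<And>n c i. \<bar>apply_bcontfun (W n c) i\<bar> \<le> h i n * norm c"
  obtains s :: "nat \<Rightarrow> nat" where "strict_mono s"
    "\<And>M a i c. i < M \<Longrightarrow> \<delta> / 4 * norm (a i) \<le> norm (\<phi> c + (\<Sum>j<M. W (s j) (a j)))"
proof -
  \<comment> \<open>All \<open>W i\<close> up to \<open>m\<close> are included, so a choice depends
    only on the last index. Images of \<open>Basis\<close> span the ranges of the linear maps and
    keep \<open>B m\<close> finite.\<close>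
  define B where "B m = \<phi> ` Basis \<union> (\<Union>i\<le>m. W i ` Basis)" for m
  \<comment> \<open>The values decrease from 2 and stay above 1, so the ratios of neighbours are
    below 1 while their products telescope to more than 1/2.\<close>
  define \<alpha> where "\<alpha> k = real (k + 2) / real (k + 1)" for k
  have \<alpha>: "1 \<le> \<alpha> k" "\<alpha> k \<le> 2" "\<alpha> (Suc k) < \<alpha> k" for k
    by (simp_all add: \<alpha>_def field_simps)
  have \<alpha>_pos: "\<alpha> k > 0" for k
    using \<alpha>(1)[of k] by simp
  have "\<exists>n>m. \<forall>e\<in>span (B m). \<forall>c. \<alpha> (Suc k) / \<alpha> k * norm e \<le> norm (e + W n c)" for m k
  proof -
    have "finite (B m)" by (simp add: B_def)
    then have "\<forall>\<^sub>F n in sequentially. \<forall>e\<in>span (B m). \<forall>c. \<alpha> (Suc k) / \<alpha> k * norm e \<le> norm (e + W n c)"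
      using lin(1) lower null
      by (rule coordinatewise_null_almost_transversal) (use \<alpha> \<alpha>_pos in \<open>simp add: field_simps\<close>)
    from eventually_conj[OF this eventually_gt_at_top[of m]] show ?thesis
      using eventually_happens'[OF sequentially_bot] by blast
  qed
  then obtain s0 :: "nat \<Rightarrow> nat" where s0: "\<And>k. s0 k < s0 (Suc k)"
    "\<And>k e c. e \<in> span (B (s0 k)) \<Longrightarrow> \<alpha> (Suc k) / \<alpha> k * norm e \<le> norm (e + W (s0 (Suc k)) c)"
    using dependent_nat_choice[of "\<lambda>_ _. True" "\<lambda>k m n. m < n \<and>
      (\<forall>e\<in>span (B m). \<forall>c. \<alpha> (Suc k) / \<alpha> k * norm e \<le> norm (e + W n c))"] by blast
  have s0_mono: "strict_mono s0" using s0(1) by (simp add: strict_mono_Suc_iff)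
  \<comment> \<open>The shift makes \<open>s k\<close> the index chosen against
    \<open>B (s0 k)\<close>, whose span contains the partial sum of the first \<open>k\<close>
    terms.\<close>
  define s where "s k = s0 (Suc k)" for k
  have "strict_mono s" using s0(1) by (simp add: s_def strict_mono_Suc_iff)
  moreover have "\<delta> / 4 * norm (a i) \<le> norm (\<phi> c + (\<Sum>j<M. W (s j) (a j)))" if i: "i < M" for M a i c
  proof -
    define e where "e k = \<phi> c + (\<Sum>j<k. W (s j) (a j))" for k
    have e_Suc: "e (Suc k) = e k + W (s k) (a k)" for k
      by (simp add: e_def add.assoc)
    have in_span: "f c \<in> span (f ` Basis)" if "linear f" for f :: "'k \<Rightarrow> (nat \<Rightarrow>\<^sub>C real)" and c
      using that by (simp add: linear_span_image)
    have "e k \<in> span (B (s0 k))" for k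
    proof -
      have "\<phi> c \<in> span (B (s0 k))"
        using in_span[OF lin(2)] span_mono[of "\<phi> ` Basis" "B (s0 k)"] by (auto simp: B_def)
      moreover have "W (s j) (a j) \<in> span (B (s0 k))" if "j < k" for j
      proof -
        have "s j \<le> s0 k"
          using that s0_mono by (simp add: s_def strict_mono_less_eq)
        then have "W (s j) ` Basis \<subseteq> B (s0 k)" by (auto simp: B_def)
        then show ?thesis using in_span[OF lin(1)] span_mono by blast
      qed
      ultimately show ?thesis
        unfolding e_def by (intro span_add span_sum) auto
    qed
    then have "\<alpha> (Suc k) / \<alpha> k * norm (e k) \<le> norm (e (Suc k))" for k
      unfolding e_Suc s_def by (rule s0(2))
    then have "norm (e k) / \<alpha> k \<le> norm (e (Suc k)) / \<alpha> (Suc k)" for k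
      using \<alpha>_pos[of k] \<alpha>_pos[of "Suc k"] by (simp add: field_simps)
    then have mono: "norm (e k) / \<alpha> k \<le> norm (e M) / \<alpha> M" if "k \<le> M" for k
      using that by (rule lift_Suc_mono_le[of "\<lambda>k. norm (e k) / \<alpha> k"])
    have e_le: "norm (e k) \<le> 2 * norm (e M)" if "k \<le> M" for k
    proof -
      have "norm (e k) / 2 \<le> norm (e k) / \<alpha> k"
        using \<alpha>[of k] by (intro divide_left_mono) (auto intro: mult_pos_pos \<alpha>_pos)
      also have "\<dots> \<le> norm (e M) / \<alpha> M" by (rule mono[OF that])
      also have "\<dots> \<le> norm (e M)"
        using \<alpha>(1)[of M] \<alpha>_pos[of M] mult_left_mono[of 1 "\<alpha> M" "norm (e M)"] by (simp add: field_simps)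
      finally show ?thesis by simp
    qed
    have "\<delta> * norm (a i) \<le> norm (e (Suc i) - e i)"
      using lower(2)[of "a i" "s i"] by (simp add: e_Suc)
    also have "\<dots> \<le> 4 * norm (e M)"
      using norm_triangle_ineq4[of "e (Suc i)" "e i"] e_le[of i] e_le[of "Suc i"] i by simp
    finally show ?thesis by (simp add: e_def)
  qed
  ultimately show thesis using that by blast
qed

section \<open>Spans over the scalar field\<close>

context banach_space_over
begin

lemma linear_scale_left: "linear (\<lambda>c. scale c v)"
  by (intro linearI)
    (simp_all add: scale_left_distrib scaleR_conv_of_real scale_of_real flip: scale_scale)

lemma linear_scale_right: "linear (scale c)"
proof (rule linearI)
  fix r :: real and v
  have "scale c (scale (of_real r) v) = scale (of_real r) (scale c v)"
    by (rule scale_left_commute)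
  then show "scale c (r *\<^sub>R v) = r *\<^sub>R scale c v" by (simp only: scale_of_real)
qed (rule scale_right_distrib)

lemma bounded_linear_scale_right: "bounded_linear (scale c)"
  using linear_scale_right
  by (intro bounded_linear_intro[of _ "norm c"]) (simp_all add: linear_add linear_scale norm_scale)

lemma subspace_closed_span: "subspace (closed_span S)"
proof (rule subspaceI)
  show "0 \<in> closed_span S"
    unfolding closed_span_def using span_zero closure_subset by blast
next
  fix u v
  assume "u \<in> closed_span S" "v \<in> closed_span S"
  then obtain f g where "\<And>n. f n \<in> span S" "f \<longlonglongrightarrow> u" "\<And>n. g n \<in> span S" "g \<longlonglongrightarrow> v"
    unfolding closed_span_def closure_sequential by blast
  then have "\<And>n. f n + g n \<in> span S" "(\<lambda>n. f n + g n) \<longlonglongrightarrow> u + v"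
    by (auto intro: span_add tendsto_add)
  then show "u + v \<in> closed_span S"
    unfolding closed_span_def closure_sequential by (intro exI[of _ "\<lambda>n. f n + g n"]) blast
next
  fix c v
  assume "v \<in> closed_span S"
  then obtain f where "\<And>n. f n \<in> span S" "f \<longlonglongrightarrow> v"
    unfolding closed_span_def closure_sequential by blast
  then have "\<And>n. scale c (f n) \<in> span S" "(\<lambda>n. scale c (f n)) \<longlonglongrightarrow> scale c v"
    by (auto intro: span_scale bounded_linear.tendsto[OF bounded_linear_scale_right])
  then show "scale c v \<in> closed_span S"
    unfolding closed_span_def closure_sequential by (intro exI[of _ "\<lambda>n. scale c (f n)"]) blast
qed

text \<open>Coefficients are drawn from a countable dense set of scalars; combinations are coded by
  lists of coefficient-vector pairs, of which there are countably many.\<close>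

lemma countable_dense_span:
  assumes "countable S"
  obtains D where "countable D" "span S \<subseteq> closure D"
proof -
  obtain K :: "'k set" where K: "countable K" "\<And>X. open X \<Longrightarrow> X \<noteq> {} \<Longrightarrow> \<exists>k\<in>K. k \<in> X"
    using countable_dense_exists by blast
  define comb where "comb = (\<lambda>cs. foldr (\<lambda>(c, v) y. scale c v + y) cs (0::'a))"
  define D where "D = comb ` lists (K \<times> S)"
  have "countable D"
    unfolding D_def using K(1) assms by (intro countable_image countable_lists countable_SIGMA) auto
  moreover have "y \<in> closure D" if "y \<in> span S" for y
    using that
  proof (induction rule: span_induct_alt)
    case base
    have "comb [] \<in> D" unfolding D_def by (intro imageI) auto
    then show ?case using closure_subset by (auto simp: comb_def)
  next
    case (step c v y)
    show ?case
      unfolding closure_approachable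
    proof (intro allI impI)
      fix \<epsilon> :: real
      assume "\<epsilon> > 0"
      then obtain y' where y': "y' \<in> D" "dist y' y < \<epsilon> / 2"
        using step.IH closure_approachable by (metis half_gt_zero)
      \<comment> \<open>Adding 1 keeps the denominator positive when \<open>v = 0\<close>.\<close>
      define \<eta> where "\<eta> = \<epsilon> / (2 * (norm v + 1))"
      have "norm v + 1 > 0" by (simp add: add_nonneg_pos)
      then have \<eta>: "\<eta> > 0" "\<eta> * norm v \<le> \<epsilon> / 2"
        using \<open>\<epsilon> > 0\<close> by (simp_all add: \<eta>_def field_simps)
      obtain c' where c': "c' \<in> K" "dist c c' < \<eta>"
        using K(2)[of "ball c \<eta>"] \<eta>(1) by auto
      obtain cs where cs: "cs \<in> lists (K \<times> S)" "y' = comb cs"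
        using y'(1) by (auto simp: D_def)
      have "comb ((c', v) # cs) \<in> D"
        unfolding D_def using cs(1) c'(1) step.hyps by (intro imageI) auto
      then have "scale c' v + y' \<in> D" by (simp add: comb_def cs(2))
      moreover have "dist (scale c' v + y') (scale c v + y) < \<epsilon>"
      proof -
        have "norm (scale (c' - c) v) \<le> \<epsilon> / 2"
          using c'(2) \<eta>(2) mult_right_mono[of "norm (c' - c)" \<eta> "norm v"]
          by (simp add: norm_scale dist_norm norm_minus_commute)
        moreover have "scale c' v + y' - (scale c v + y) = scale (c' - c) v + (y' - y)"
          by (simp add: scale_left_diff_distrib)
        ultimately show ?thesis
          using y'(2) norm_triangle_ineq[of "scale (c' - c) v" "y' - y"]
          by (simp only: dist_norm)
      qed
      ultimately show "\<exists>z\<in>D. dist z (scale c v + y) < \<epsilon>" by blast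
    qed
  qed
  ultimately show thesis using that by blast
qed

section \<open>Uniformly minimal subsequences\<close>

text \<open>The estimate says that the coefficient functionals of the subsequence are uniformly
  bounded on its span.\<close>

lemma separated_bounded_subsequence_lower_bound:
  fixes x :: "nat \<Rightarrow> 'a"
  assumes "bounded (range x)" and d: "d > 0" "\<And>i j. i \<noteq> j \<Longrightarrow> d \<le> dist (x i) (x j)"
  obtains s :: "nat \<Rightarrow> nat" and \<gamma> where "strict_mono s" "\<gamma> > 0"
    "\<And>M a i. i < M \<Longrightarrow> \<gamma> * norm (a i) \<le> norm (\<Sum>j<M. scale (a j) (x (s j)))"
proof -
  obtain C where C: "\<And>n. norm (x n) \<le> C"
    using assms(1) by (auto simp: bounded_iff)
  obtain D where D: "countable D" "span (range x) \<subseteq> closure D"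
    using countable_dense_span[of "range x"] by auto
  obtain T :: "'a \<Rightarrow> (nat \<Rightarrow>\<^sub>C real)" where T: "linear T" "\<And>y. norm (T y) \<le> norm y"
    and isometric: "\<And>y. y \<in> closure D \<Longrightarrow> norm (T y) = norm y"
    by (rule embedding_isometric_on_separable[OF D(1)]) (rule that)
  have T_norm: "norm (T y) = norm y" if "y \<in> span (range x)" for y
    using that D(2) by (intro isometric) blast
  \<comment> \<open>\<open>T\<close> is only real-linear, so a complex scalar cannot be pulled out
    of it; the whole map in \<open>c\<close> takes the place of the vector.\<close>
  have T_scale: "linear (\<lambda>c. T (scale c v))" for v
    using linear_compose[OF linear_scale_left T(1)] by (simp add: o_def)
  define g where "g n i = (\<Sum>b\<in>Basis. apply_bcontfun (T (scale b (x n))) i *\<^sub>R b)" for n i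
  have g: "apply_bcontfun (T (scale c (x n))) i = g n i \<bullet> c" for n i c
    unfolding g_def
    using T_scale[of "x n"]
    by (intro linear_functional_inner[of "\<lambda>c. apply_bcontfun (T (scale c (x n))) i"])
      (auto simp: linear_iff)
  define K where "K = DIM('k) * C"
  have g_le: "norm (g n i) \<le> K" for n i
  proof -
    have "\<bar>apply_bcontfun (T (scale b (x n))) i\<bar> \<le> C" if "b \<in> Basis" for b
      using norm_bounded[of "T (scale b (x n))" i] T(2)[of "scale b (x n)"] C[of n] that
      by (simp add: norm_scale)
    then have "norm (g n i) \<le> (\<Sum>b\<in>(Basis::'k set). C)"
      unfolding g_def by (intro sum_norm_le) simp
    then show ?thesis by (simp add: K_def)
  qed
  obtain l and r :: "nat \<Rightarrow> nat" where r: "strict_mono r" and l: "\<And>i. (\<lambda>n. g (r n) i) \<longlonglongrightarrow> l i"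
    by (rule bounded_family_pointwise_convergent_subseq[of g K, OF g_le]) (rule that)
  have l_le: "norm (l i) \<le> K" for i
    by (rule LIMSEQ_le_const2[OF tendsto_norm[OF l]]) (use g_le in auto)
  define \<phi> where "\<phi> c = Bcontfun (\<lambda>i. l i \<bullet> c)" for c
  have inner_l_le: "\<bar>l i \<bullet> c\<bar> \<le> K * norm c" for i c
    using Cauchy_Schwarz_ineq2[of "l i" c] mult_right_mono[OF l_le[of i], of "norm c"] by simp
  have "(\<lambda>i. l i \<bullet> c) \<in> bcontfun" for c
    using inner_l_le by (intro bcontfun_normI[of _ "K * norm c"]) auto
  then have \<phi>: "apply_bcontfun (\<phi> c) i = l i \<bullet> c" for c i
    by (simp add: \<phi>_def Bcontfun_inverse)
  have lin_\<phi>: "linear \<phi>"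
    by (intro linearI bcontfun_eqI) (simp_all add: \<phi> inner_add_right)
  \<comment> \<open>Subtracting the limit makes all coordinates null, while it cancels in
    differences and so preserves the separation.\<close>
  define W where "W n c = T (scale c (x (r n))) - \<phi> c" for n c
  have lin_W: "linear (W n)" for n
    unfolding W_def by (intro linear_compose_sub T_scale lin_\<phi>)
  have W: "apply_bcontfun (W n c) i = (g (r n) i - l i) \<bullet> c" for n c i
    by (simp add: W_def \<phi> g inner_diff_left)
  have W_diff: "norm (W n c - W m c) = norm c * dist (x (r n)) (x (r m))" for n m c
  proof -
    have "W n c - W m c = T (scale c (x (r n) - x (r m)))"
      using T(1) by (simp add: W_def scale_right_diff_distrib linear_diff)
    moreover have "scale c (x (r n) - x (r m)) \<in> span (range x)"
      by (intro span_scale span_diff span_base) auto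
    ultimately show ?thesis by (simp add: T_norm norm_scale dist_norm)
  qed
  have "\<forall>\<^sub>F n in sequentially. \<forall>c. d / 4 * norm c \<le> norm (W n c)"
  proof (rule eventually_uniformly_bounded_below[OF lin_W _ d(1)])
    show "norm (W n c) \<le> (C + K) * norm c" for n c
    proof -
      have "norm (T (scale c (x (r n)))) \<le> norm c * C"
        using T(2)[of "scale c (x (r n))"] mult_left_mono[OF C[of "r n"], of "norm c"]
        by (simp add: norm_scale)
      moreover have "norm (\<phi> c) \<le> K * norm c"
        using inner_l_le by (intro norm_bound) (simp add: \<phi>)
      ultimately show ?thesis
        unfolding W_def using norm_triangle_ineq4[of "T (scale c (x (r n)))" "\<phi> c"]
        by (simp add: algebra_simps)
    qed
    show "d * norm c \<le> norm (W n c - W m c)" if "n \<noteq> m" for n m c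
      using mult_right_mono[OF d(2)[of "r n" "r m"], of "norm c"] that r
      by (simp add: W_diff strict_mono_eq mult.commute)
  qed
  then obtain N where N: "\<And>n c. n \<ge> N \<Longrightarrow> d / 4 * norm c \<le> norm (W n c)"
    by (auto simp: eventually_sequentially)
  have null: "(\<lambda>n. norm (g (r (n + N)) i - l i)) \<longlonglongrightarrow> 0" for i
    using LIMSEQ_ignore_initial_segment[OF l, of N i] by (simp add: LIM_zero tendsto_norm_zero)
  \<comment> \<open>Dropping the first \<open>N\<close> maps makes the lower bound hold for all that
    remain, as the selection demands.\<close>
  obtain s :: "nat \<Rightarrow> nat" where s: "strict_mono s" "\<And>M a i c. i < M \<Longrightarrow>
      d / 4 / 4 * norm (a i) \<le> norm (\<phi> c + (\<Sum>j<M. W (s j + N) (a j)))"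
    by (rule uniformly_minimal_selection[of "\<lambda>n. W (n + N)" \<phi> "d / 4"
          "\<lambda>i n. norm (g (r (n + N)) i - l i)"])
      (use lin_W lin_\<phi> d(1) N null in \<open>auto simp: W Cauchy_Schwarz_ineq2\<close>)
  have "d / 16 * norm (a i) \<le> norm (\<Sum>j<M. scale (a j) (x (r (s j + N))))" if "i < M" for M a i
  proof -
    have "(\<Sum>j<M. scale (a j) (x (r (s j + N)))) \<in> span (range x)"
      by (intro span_sum span_scale span_base) auto
    then have "norm (\<Sum>j<M. scale (a j) (x (r (s j + N)))) =
        norm (\<Sum>j<M. T (scale (a j) (x (r (s j + N)))))"
      by (simp add: T_norm[symmetric] linear_sum[OF T(1)])
    \<comment> \<open>The limit parts collect into a single value of \<open>\<phi>\<close>; hence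
      the selection estimate has to admit an arbitrary \<open>\<phi> c\<close>.\<close>
    also have "(\<Sum>j<M. T (scale (a j) (x (r (s j + N))))) =
        \<phi> (\<Sum>j<M. a j) + (\<Sum>j<M. W (s j + N) (a j))"
      by (simp add: W_def sum_subtractf linear_sum[OF lin_\<phi>])
    finally show ?thesis using s(2)[OF that, of a] by simp
  qed
  moreover have "strict_mono (\<lambda>j. r (s j + N))"
    using r s(1) by (simp add: strict_mono_def)
  ultimately show thesis using that[of "\<lambda>j. r (s j + N)" "d / 16"] d(1) by simp
qed

text \<open>If \<open>w\<close> combines the other terms, \<open>x (s i) - w\<close> has coefficient
  1 at \<open>i\<close>, so the coefficient bound becomes a distance bound.\<close>

lemma separated_bounded_uniformly_minimal_subsequence:
  fixes x :: "nat \<Rightarrow> 'a"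
  assumes "bounded (range x)" "d > 0" "\<And>i j. i \<noteq> j \<Longrightarrow> d \<le> dist (x i) (x j)"
  obtains s :: "nat \<Rightarrow> nat" and \<gamma> where "strict_mono s" "\<gamma> > 0"
    "\<And>i w. w \<in> span ((x \<circ> s) ` (- {i})) \<Longrightarrow> \<gamma> \<le> dist (x (s i)) w"
proof -
  obtain s :: "nat \<Rightarrow> nat" and \<gamma> where s: "strict_mono s" "\<gamma> > 0"
    "\<And>M a i. i < M \<Longrightarrow> \<gamma> * norm (a i) \<le> norm (\<Sum>j<M. scale (a j) (x (s j)))"
    using separated_bounded_subsequence_lower_bound[OF assms] by blast
  have "\<gamma> \<le> dist (x (s i)) w" if w: "w \<in> span ((x \<circ> s) ` (- {i}))" for i w
  proof -
    \<comment> \<open>Representing \<open>w\<close> by the sums for all large \<open>M\<close> lets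
      sums of different lengths be added in the induction.\<close>
    have "\<exists>a. a i = 0 \<and> (\<forall>\<^sub>F M in sequentially. w = (\<Sum>j<M. scale (a j) (x (s j))))"
      using w
    proof (induction rule: span_induct_alt)
      case base
      then show ?case by (intro exI[of _ "\<lambda>_. 0"]) simp
    next
      case (step c v w)
      then obtain a where a: "a i = 0" "\<forall>\<^sub>F M in sequentially. w = (\<Sum>j<M. scale (a j) (x (s j)))"
        by blast
      obtain k where k: "k \<noteq> i" "v = x (s k)" using step.hyps by auto
      have "\<forall>\<^sub>F M in sequentially.
          scale c v + w = (\<Sum>j<M. scale (a j + (if j = k then c else 0)) (x (s j)))"
        using a(2) eventually_gt_at_top[of k]
      proof eventually_elim
        case (elim M)
        have "(\<Sum>j<M. scale (if j = k then c else 0) (x (s j))) = (\<Sum>j<M. if j = k then scale c v else 0)"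
          by (intro sum.cong) (auto simp: k(2))
        also have "\<dots> = scale c v" using elim(2) by simp
        finally show ?case using elim(1) by (simp add: scale_left_distrib sum.distrib)
      qed
      then show ?case
        using a(1) k(1) by (intro exI[of _ "\<lambda>j. a j + (if j = k then c else 0)"]) auto
    qed
    then obtain a where a: "a i = 0" "\<forall>\<^sub>F M in sequentially. w = (\<Sum>j<M. scale (a j) (x (s j)))"
      by blast
    obtain M where M: "i < M" "w = (\<Sum>j<M. scale (a j) (x (s j)))"
      using eventually_happens'[OF sequentially_bot eventually_conj[OF a(2) eventually_gt_at_top[of i]]]
      by blast
    have "(\<Sum>j<M. scale (if j = i then 1 else 0) (x (s j))) = (\<Sum>j<M. if j = i then x (s i) else 0)"
      by (intro sum.cong) auto
    also have "\<dots> = x (s i)" using M(1) by simp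
    finally have "x (s i) - w = (\<Sum>j<M. scale ((if j = i then 1 else 0) - a j) (x (s j)))"
      by (simp add: M(2) scale_left_diff_distrib sum_subtractf)
    then show ?thesis
      using s(3)[OF M(1), of "\<lambda>j. (if j = i then 1 else 0) - a j"] a(1) by (simp add: dist_norm)
  qed
  then show thesis using that s(1,2) by blast
qed

section \<open>Infinite codimension and the conclusion\<close>

text \<open>With finite codimension, each \<open>y i\<close> has a representative \<open>b i\<close>
  in one finitely generated span. A linear relation among the \<open>b i\<close> with
  \<open>i\<close> in \<open>I\<close> puts some \<open>y k\<close> into the closed span of the
  other terms.\<close>

lemma minimal_imp_infinite_codimension:
  fixes y :: "nat \<Rightarrow> 'a"
  assumes min: "\<And>i. y i \<notin> closed_span (y ` (- {i}))" and "infinite I"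
  shows "\<not> finite_codimension (closed_span (y ` (- I)))"
proof
  assume "finite_codimension (closed_span (y ` (- I)))"
  then obtain B where B: "finite B" "\<And>v. \<exists>b\<in>span B. v - b \<in> closed_span (y ` (- I))"
    by (auto simp: finite_codimension_def)
  then have "\<exists>b. b \<in> span B \<and> y i - b \<in> closed_span (y ` (- I))" for i by blast
  then obtain b where b: "\<And>i. b i \<in> span B" "\<And>i. y i - b i \<in> closed_span (y ` (- I))"
    by metis
  \<comment> \<open>The relation is indexed by terms, not by values: either two indices share a
    representative, or infinitely many distinct representatives are dependent.\<close>
  obtain J c k where J: "finite J" "J \<subseteq> I" "k \<in> J" "c k \<noteq> 0" "(\<Sum>j\<in>J. scale (c j) (b j)) = 0"
  proof (cases "inj_on b I")
    case True
    then have "infinite (b ` I)" using assms(2) by (simp add: finite_image_iff)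
    moreover have "b ` I \<subseteq> span B" using b(1) by blast
    ultimately have "dependent (b ` I)"
      using independent_span_bound[OF B(1)] by blast
    then obtain S u v where S: "finite S" "S \<subseteq> b ` I" "v \<in> S" "u v \<noteq> 0"
      "(\<Sum>v\<in>S. scale (u v) v) = 0"
      by (auto simp: dependent_explicit)
    define J where "J = I \<inter> b -` S"
    have "b ` J = S" using S(2) by (auto simp: J_def)
    moreover have inj: "inj_on b J" using True by (rule inj_on_subset) (auto simp: J_def)
    moreover obtain k where "k \<in> J" "b k = v" using S(3) \<open>b ` J = S\<close> by blast
    ultimately show thesis
      using S that[of J k "u \<circ> b"] sum.reindex[OF inj, of "\<lambda>v. scale (u v) v"]
        finite_image_iff[OF inj]
      by (simp add: J_def o_def)
  next
    case False
    then obtain i j where "i \<in> I" "j \<in> I" "i \<noteq> j" "b i = b j" by (auto simp: inj_on_def)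
    then show thesis
      using that[of "{i, j}" i "\<lambda>l. if l = i then 1 else - 1"] by simp
  qed
  \<comment> \<open>As \<open>k \<in> I\<close>, this subspace contains both the one factored out
    and every other \<open>y j\<close>.\<close>
  define Y where "Y = closed_span (y ` (- {k}))"
  have Y: "subspace Y" unfolding Y_def by (rule subspace_closed_span)
  have in_Y: "y j \<in> Y" if "j \<noteq> k" for j
    unfolding Y_def closed_span_def
    using that by (intro subsetD[OF closure_subset] span_base imageI) auto
  have "closed_span (y ` (- I)) \<subseteq> Y"
    unfolding Y_def closed_span_def using J(2,3) by (intro closure_mono span_mono image_mono) auto
  then have "(\<Sum>j\<in>J. scale (c j) (y j - b j)) \<in> Y"
    using b(2) by (intro subspace_sum[OF Y] subspace_scale[OF Y]) auto
  then have "(\<Sum>j\<in>J. scale (c j) (y j)) \<in> Y"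
    using J(5) by (simp add: scale_right_diff_distrib sum_subtractf)
  moreover have "(\<Sum>j\<in>J - {k}. scale (c j) (y j)) \<in> Y"
    using in_Y by (intro subspace_sum[OF Y] subspace_scale[OF Y]) auto
  ultimately have "(\<Sum>j\<in>J. scale (c j) (y j)) - (\<Sum>j\<in>J - {k}. scale (c j) (y j)) \<in> Y"
    by (rule subspace_diff[OF Y])
  also have "(\<Sum>j\<in>J. scale (c j) (y j)) - (\<Sum>j\<in>J - {k}. scale (c j) (y j)) = scale (c k) (y k)"
    by (simp add: sum.remove[OF J(1,3)])
  finally have "scale (c k) (y k) \<in> Y" .
  then have "scale (inverse (c k)) (scale (c k) (y k)) \<in> Y" by (rule subspace_scale[OF Y])
  then show False using min[of k] J(4) by (simp add: Y_def)
qed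

lemma almost_overcomplete_bounded_imp_compact_closure:
  fixes x :: "nat \<Rightarrow> 'a"
  assumes "bounded (range x)" "almost_overcomplete x"
  shows "compact (closure (range x))"
proof (rule ccontr)
  assume "\<not> ?thesis"
  then obtain r :: "nat \<Rightarrow> nat" and d where r: "strict_mono r" "d > 0"
    "\<And>i j. i \<noteq> j \<Longrightarrow> d \<le> dist ((x \<circ> r) i) ((x \<circ> r) j)"
    using separated_subsequence[of x] unfolding comp_apply by blast
  have "bounded (range (x \<circ> r))"
    using assms(1) by (rule bounded_subset) auto
  then obtain s :: "nat \<Rightarrow> nat" and \<gamma> where s: "strict_mono s" "\<gamma> > 0"
    "\<And>i w. w \<in> span ((x \<circ> r \<circ> s) ` (- {i})) \<Longrightarrow> \<gamma> \<le> dist ((x \<circ> r) (s i)) w"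
    using separated_bounded_uniformly_minimal_subsequence[of "x \<circ> r" d, OF _ r(2) r(3)] by blast
  define y where "y = x \<circ> r \<circ> s"
  \<comment> \<open>The same \<open>\<gamma>\<close> works for all \<open>w\<close> in the span, so
    the distance survives taking the closure.\<close>
  have "y i \<notin> closed_span (y ` (- {i}))" for i
  proof
    assume "y i \<in> closed_span (y ` (- {i}))"
    then obtain w where "w \<in> span (y ` (- {i}))" "dist w (y i) < \<gamma>"
      using s(2) unfolding closed_span_def closure_approachable by blast
    then show False using s(3)[of w i] by (simp add: y_def dist_commute)
  qed
  moreover have "infinite {i :: nat. odd i}"
    unfolding infinite_nat_iff_unbounded
  proof
    fix m :: nat
    show "\<exists>n>m. n \<in> {i. odd i}" by (rule exI[of _ "2 * m + 1"]) simp
  qed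
  ultimately have "\<not> finite_codimension (closed_span (y ` (- {i. odd i})))"
    by (rule minimal_imp_infinite_codimension)
  \<comment> \<open>The even terms form a subsequence of \<open>x\<close>, to which almost
    overcompleteness applies.\<close>
  moreover have "y ` (- {i. odd i}) = range (x \<circ> (\<lambda>n. r (s (2 * n))))"
    by (auto simp: y_def elim: evenE)
  moreover have "strict_mono (\<lambda>n. r (s (2 * n)))"
    using r(1) s(1) by (simp add: strict_mono_def)
  ultimately show False
    using assms(2) by (auto simp: almost_overcomplete_def)
qed

end

theorem theorem2p1:
  fixes scale :: "'k::{real_normed_field,euclidean_space} \<Rightarrow> 'a::banach \<Rightarrow> 'a"
    and x :: "nat \<Rightarrow> 'a"
  assumes "banach_space_over scale"
    and "bounded (range x)"
    and "banach_space_over.almost_overcomplete scale x"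
  shows "compact (closure (range x))"
  using assms by (rule banach_space_over.almost_overcomplete_bounded_imp_compact_closure)

end
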